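(* Let $G$ be a $2$-connected $[4,2]$-graph of order $n\ge 10$. Then $e(G)\ge \lfloor (n-1)^2/4\rfloor+2$, with equality if and only if $G$ is isomorphic to $B_n^+$.
   Context: All graphs are finite and simple. $e(G)$ denotes the number of edges of $G$. For a positive integer $s$ and a nonnegative integer $t$, a graph $G$ of order at least $s$ is called an $[s,t]$-graph if every induced subgraph of $G$ on $s$ vertices has at least $t$ edges. $B_n^+$ denotes the $2$-connected graph of order $n$ obtained from the vertex-disjoint union of complete graphs $K_{\lfloor n/2\rfloor}$ and $K_{\lceil n/2\rceil}$ by adding two edges (necessarily two vertex-disjoint edges each joining the two cliques). *)

theory Defs
  imports Main
begin

record 'a ugraph =
  verts :: "'a set"
  edges :: "'a set set"

definition pairs :: "'a set \<Rightarrow> 'a set set" where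
  "pairs A = {e. e \<subseteq> A \<and> card e = 2}"

definition simple_graph :: "'a ugraph \<Rightarrow> bool" where
  "simple_graph G \<longleftrightarrow> finite (verts G) \<and> edges G \<subseteq> pairs (verts G)"

definition order :: "'a ugraph \<Rightarrow> nat" where
  "order G = card (verts G)"

definition num_edges :: "'a ugraph \<Rightarrow> nat" where
  "num_edges G = card (edges G)"

definition induced :: "'a ugraph \<Rightarrow> 'a set \<Rightarrow> 'a ugraph" where
  "induced G S = \<lparr>verts = S, edges = {e \<in> edges G. e \<subseteq> S}\<rparr>"

definition adj_rel :: "'a ugraph \<Rightarrow> ('a \<times> 'a) set" where
  "adj_rel G = {(u, v). {u, v} \<in> edges G}"

definition connected_graph :: "'a ugraph \<Rightarrow> bool" where
  "connected_graph G \<longleftrightarrow>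
     verts G \<noteq> {} \<and> (\<forall>u \<in> verts G. \<forall>v \<in> verts G. (u, v) \<in> (adj_rel G)\<^sup>*)"

definition k_connected :: "nat \<Rightarrow> 'a ugraph \<Rightarrow> bool" where
  "k_connected k G \<longleftrightarrow>
     order G > k \<and>
     (\<forall>X \<subseteq> verts G. card X < k \<longrightarrow> connected_graph (induced G (verts G - X)))"

definition st_graph :: "nat \<Rightarrow> nat \<Rightarrow> 'a ugraph \<Rightarrow> bool" where
  "st_graph s t G \<longleftrightarrow>
     order G \<ge> s \<and>
     (\<forall>S \<subseteq> verts G. card S = s \<longrightarrow> num_edges (induced G S) \<ge> t)"

definition graph_iso :: "'a ugraph \<Rightarrow> 'b ugraph \<Rightarrow> bool" where
  "graph_iso G H \<longleftrightarrow>
     (\<exists>f. bij_betw f (verts G) (verts H) \<and>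
          (\<forall>u \<in> verts G. \<forall>v \<in> verts G. {u, v} \<in> edges G \<longleftrightarrow> {f u, f v} \<in> edges H))"

text \<open>
  The cliques of \<open>B_plus n\<close> are \<open>{0..<n div 2}\<close> and \<open>{n div 2..<n}\<close>, of sizes
  \<open>\<lfloor>n/2\<rfloor>\<close> and \<open>\<lceil>n/2\<rceil>\<close>. The two added edges must be disjoint for the graph to be
  2-connected, so up to isomorphism their position is immaterial. The definition is
  meaningful for \<open>n \<ge> 4\<close> only.
\<close>

definition B_plus :: "nat \<Rightarrow> nat ugraph" where
  "B_plus n =
     \<lparr>verts = {0..<n},
      edges = pairs {0..<n div 2} \<union> pairs {n div 2..<n} \<union>
              {{0, n div 2}, {1, n div 2 + 1}}\<rparr>"

lemma simple_graph_B_plus: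
  assumes "n \<ge> 4"
  shows "simple_graph (B_plus n)"
proof -
  have "n div 2 \<ge> 2" "n div 2 + 1 < n" using assms by auto
  then show ?thesis
    by (auto simp: simple_graph_def B_plus_def pairs_def card_insert_if)
qed

lemma two_connected_B_plus:
  assumes n: "n \<ge> 4"
  shows "k_connected 2 (B_plus n)"
proof -
  define h where "h = n div 2"
  have h: "h \<ge> 2" "h + 1 < n" using n by (auto simp: h_def)
  have V: "verts (B_plus n) = {0..<n}" by (simp add: B_plus_def)
  have E: "edges (B_plus n) =
      pairs {0..<h} \<union> pairs {h..<n} \<union> {{0, h}, {1, h + 1}}"
    by (simp add: B_plus_def h_def)
  have "connected_graph (induced (B_plus n) ({0..<n} - X))"
    if X: "X \<subseteq> {0..<n}" "card X < 2" for X
  proof -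
    let ?H = "induced (B_plus n) ({0..<n} - X)"
    let ?R = "(adj_rel ?H)\<^sup>*"
    have finX: "finite X" using X(1) finite_subset by blast
    have one: "x = y" if "x \<in> X" "y \<in> X" for x y
    proof (rule ccontr)
      assume "x \<noteq> y"
      then have "card {x, y} = 2" by simp
      moreover have "card {x, y} \<le> card X"
        using that finX by (intro card_mono) auto
      ultimately show False using X(2) by simp
    qed
    have sym: "sym ?R"
      by (intro sym_rtrancl symI) (auto simp: adj_rel_def insert_commute)
    have adj: "(u, v) \<in> ?R"
      if "u \<in> {0..<n} - X" "v \<in> {0..<n} - X" "u < h \<longleftrightarrow> v < h" for u v
    proof (cases "u = v")
      case False
      then have "{u, v} \<in> pairs {0..<h} \<union> pairs {h..<n}"
        using that by (auto simp: pairs_def)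
      then have "(u, v) \<in> adj_rel ?H"
        using that by (auto simp: adj_rel_def induced_def E)
      then show ?thesis by blast
    qed simp
    obtain i where i: "i < 2" "i \<notin> X" "h + i \<notin> X"
    proof (cases "0 \<notin> X \<and> h \<notin> X")
      case True
      then show ?thesis using that[of 0] by simp
    next
      case False
      then have "1 \<notin> X \<and> h + 1 \<notin> X"
        using one[of 0 1] one[of 0 "h + 1"] one[of h 1] one[of h "h + 1"] h(1) by auto
      then show ?thesis using that[of 1] by simp
    qed
    have iV: "i \<in> {0..<n} - X" "h + i \<in> {0..<n} - X" "i < h" using i h by auto
    have "i = 0 \<or> i = 1" using i by auto
    then have "(i, h + i) \<in> adj_rel ?H"
      using iV by (auto simp: adj_rel_def induced_def E)
    then have bridge: "(i, h + i) \<in> ?R" by blast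
    have to_i: "(u, i) \<in> ?R" if u: "u \<in> {0..<n} - X" for u
    proof (cases "u < h")
      case True
      then show ?thesis using adj[OF u iV(1)] iV by simp
    next
      case False
      then have "(u, h + i) \<in> ?R" using adj[OF u iV(2)] by simp
      then show ?thesis using bridge sym by (meson rtrancl_trans symD)
    qed
    have "(u, v) \<in> ?R" if "u \<in> {0..<n} - X" "v \<in> {0..<n} - X" for u v
      using to_i[OF that(1)] to_i[OF that(2)] sym by (meson rtrancl_trans symD)
    moreover have "verts ?H = {0..<n} - X" by (simp add: induced_def)
    ultimately show ?thesis using iV by (auto simp: connected_graph_def)
  qed
  then show ?thesis using n by (auto simp: k_connected_def order_def V)
qed

end

theory Submission
  imports Defs
begin

text \<open>
  \<open>G\<close> is a \<open>[4,2]\<close>-graph iff its complement \<open>F\<close> contains no diamond (\<open>K\<^sub>4\<close> minus an edge), and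
  \<open>n choose 2 = \<lfloor>(n-1)\<^sup>2/4\<rfloor> + \<lfloor>n\<^sup>2/4\<rfloor>\<close>, so the question is how close \<open>F\<close> can come to the Turan
  bound \<open>\<lfloor>n\<^sup>2/4\<rfloor>\<close>. If \<open>F\<close> is not bipartite, it misses that bound by at least 3: every vertex
  outside a triangle of \<open>F\<close> has at most one neighbour in it, so a triangle allows at most \<open>n\<close> edges
  more than \<open>n - 3\<close> vertices carry; without triangles a stability version of Mantel's theorem applies.
  If \<open>F\<close> is bipartite, then \<open>V\<close> splits into two cliques of \<open>G\<close>, and 2-connectedness provides two
  disjoint edges between them; equality leaves only \<open>B\<^sub>n\<^sup>+\<close>.
\<close>

section \<open>Edge counts inside and between vertex sets\<close>

definition nbhd :: "'a set set \<Rightarrow> 'a set \<Rightarrow> 'a \<Rightarrow> 'a set" where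
  "nbhd F U v = {u \<in> U. {v, u} \<in> F}"

text \<open>Ordered adjacent pairs are counted: crossing edges if the two sets are disjoint, but an
  edge with both ends in both sets counts twice.\<close>

definition arcs :: "'a set set \<Rightarrow> 'a set \<Rightarrow> 'a set \<Rightarrow> nat" where
  "arcs F T U = (\<Sum>v\<in>T. card (nbhd F U v))"

definition spanned :: "'a set set \<Rightarrow> 'a set \<Rightarrow> 'a set set" where
  "spanned F T = {e \<in> F. e \<subseteq> T}"

text \<open>Coinciding vertices do no harm: wherever this is used, members of \<open>F\<close> have
  two elements, so \<open>{a, a}\<close> is not one of them.\<close>

definition triangle_free :: "'a set set \<Rightarrow> 'a set \<Rightarrow> bool" where
  "triangle_free F S \<longleftrightarrow>
     (\<forall>a\<in>S. \<forall>b\<in>S. \<forall>c\<in>S. \<not> ({a, b} \<in> F \<and> {a, c} \<in> F \<and> {b, c} \<in> F))"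

text \<open>The pair \<open>{c, d}\<close> is left open, so \<open>K4\<close> is excluded too.
  Distinctness matters here: with \<open>c = d\<close> allowed, every triangle would be
  forbidden.\<close>

definition diamond_free :: "'a set set \<Rightarrow> 'a set \<Rightarrow> bool" where
  "diamond_free F S \<longleftrightarrow>
     (\<forall>a\<in>S. \<forall>b\<in>S. \<forall>c\<in>S. \<forall>d\<in>S. distinct [a, b, c, d] \<longrightarrow>
        \<not> ({a, b} \<in> F \<and> {a, c} \<in> F \<and> {b, c} \<in> F \<and> {a, d} \<in> F \<and> {b, d} \<in> F))"

definition independent :: "'a set set \<Rightarrow> 'a set \<Rightarrow> bool" where
  "independent F A \<longleftrightarrow> (\<forall>u\<in>A. \<forall>v\<in>A. {u, v} \<notin> F)"

lemma card_pairs: "finite A \<Longrightarrow> card (pairs A) = card A choose 2"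
  unfolding pairs_def by (rule n_subsets)

lemma finite_pairs: "finite A \<Longrightarrow> finite (pairs A)"
  unfolding pairs_def by simp

lemma arcs_Un_left:
  assumes "finite T" "finite T'" "T \<inter> T' = {}"
  shows "arcs F (T \<union> T') U = arcs F T U + arcs F T' U"
  using assms by (simp add: arcs_def sum.union_disjoint)

lemma arcs_Un_right:
  assumes "finite U" "finite U'" "U \<inter> U' = {}"
  shows "arcs F T (U \<union> U') = arcs F T U + arcs F T U'"
proof -
  have "card (nbhd F (U \<union> U') v) = card (nbhd F U v) + card (nbhd F U' v)" for v
  proof -
    have "nbhd F (U \<union> U') v = nbhd F U v \<union> nbhd F U' v" by (auto simp: nbhd_def)
    then show ?thesis using assms by (simp add: card_Un_disjoint nbhd_def disjoint_iff)
  qed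
  then show ?thesis by (simp add: arcs_def sum.distrib)
qed

lemma arcs_commute:
  assumes "finite T" "finite U"
  shows "arcs F T U = arcs F U T"
proof -
  have card: "card (nbhd F U v) = (\<Sum>u\<in>U. if {u, v} \<in> F then 1 else 0)"
    if "finite U" for U v
    using that by (simp add: nbhd_def sum.If_cases insert_commute Int_def)
  show ?thesis
    using assms by (simp add: arcs_def card sum.swap[of _ U] insert_commute)
qed

lemma nbhd_subset: "nbhd F U v \<subseteq> U"
  by (auto simp: nbhd_def)

text \<open>Inserting \<open>x\<close> into \<open>T\<close> adds its degree into \<open>T\<close>
  twice to the arcs, once from each end, and once to the edges, namely the pairs
  \<open>{x, u}\<close>.\<close>

lemma handshake:
  assumes F: "\<forall>e\<in>F. card e = 2" and "finite T"
  shows "arcs F T T = 2 * card (spanned F T)"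
  using \<open>finite T\<close>
proof induction
  case empty
  have "{} \<notin> F" using F by force
  then show ?case by (auto simp: arcs_def spanned_def)
next
  case (insert x T)
  have xx: "{x, x} \<notin> F" using F by force
  have "arcs F (insert x T) (insert x T) = arcs F ({x} \<union> T) ({x} \<union> T)" by simp
  also have "\<dots> = arcs F {x} {x} + arcs F {x} T + (arcs F T {x} + arcs F T T)"
    using insert arcs_Un_left[of "{x}" T F "{x} \<union> T"] arcs_Un_right[of "{x}" T F "{x}"]
      arcs_Un_right[of "{x}" T F T] by (simp del: Un_insert_left)
  also have "arcs F {x} {x} = 0" using xx by (simp add: arcs_def nbhd_def)
  also have "arcs F T {x} = arcs F {x} T" using insert by (simp add: arcs_commute)
  also have "arcs F {x} T = card (nbhd F T x)" by (simp add: arcs_def)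
  finally have 1: "arcs F (insert x T) (insert x T) = 2 * card (nbhd F T x) + arcs F T T" by simp
  have eq: "spanned F (insert x T) = spanned F T \<union> (\<lambda>u. {x, u}) ` nbhd F T x"
  proof (intro equalityI subsetI)
    fix e assume e: "e \<in> spanned F (insert x T)"
    show "e \<in> spanned F T \<union> (\<lambda>u. {x, u}) ` nbhd F T x"
    proof (cases "x \<in> e")
      case True
      have "card e = 2" using F e by (simp add: spanned_def)
      then obtain p q where "e = {p, q}" "p \<noteq> q" by (auto simp: card_2_iff)
      then obtain u where "e = {x, u}" "u \<noteq> x" using True by blast
      then show ?thesis using e by (auto simp: spanned_def nbhd_def)
    qed (use e in \<open>auto simp: spanned_def\<close>)
  qed (auto simp: spanned_def nbhd_def)
  have "card (spanned F (insert x T)) = card (spanned F T) + card ((\<lambda>u. {x, u}) ` nbhd F T x)"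
    unfolding eq
  proof (rule card_Un_disjoint)
    show "finite (spanned F T)"
      by (rule finite_subset[of _ "Pow T"]) (use insert in \<open>auto simp: spanned_def\<close>)
    show "finite ((\<lambda>u. {x, u}) ` nbhd F T x)" using insert by (simp add: nbhd_def)
    show "spanned F T \<inter> (\<lambda>u. {x, u}) ` nbhd F T x = {}"
      using insert by (auto simp: spanned_def)
  qed
  also have "card ((\<lambda>u. {x, u}) ` nbhd F T x) = card (nbhd F T x)"
    by (rule card_image) (auto simp: inj_on_def doubleton_eq_iff)
  finally show ?case using 1 insert.IH by simp
qed

text \<open>Expanding \<open>arcs F (A \<union> B) (A \<union> B)\<close> and halving by
  \<open>handshake\<close> avoids sorting the edges by position.\<close>

lemma card_spanned_split:
  assumes F: "\<forall>e\<in>F. card e = 2" and "finite A" "finite B" "A \<inter> B = {}"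
  shows "card (spanned F (A \<union> B)) = card (spanned F A) + arcs F B A + card (spanned F B)"
proof -
  have "arcs F (A \<union> B) (A \<union> B) = arcs F A A + 2 * arcs F B A + arcs F B B"
    using assms arcs_commute[of A B F] by (simp add: arcs_Un_left arcs_Un_right)
  then show ?thesis using assms by (simp add: handshake)
qed

lemma spanned_independent:
  assumes "\<forall>e\<in>F. card e = 2"
  shows "independent F A \<longleftrightarrow> spanned F A = {}"
proof
  assume ind: "independent F A"
  have False if "e \<in> F" "e \<subseteq> A" for e
  proof -
    have "card e = 2" using assms that by blast
    then obtain p q where "e = {p, q}" by (auto simp: card_2_iff)
    then show False using ind that by (auto simp: independent_def)
  qed
  then show "spanned F A = {}" by (auto simp: spanned_def)
qed (auto simp: independent_def spanned_def)

section \<open>Arithmetic of \<open>n\<^sup>2 div 4\<close>\<close>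

lemma mult_le_div4: "a * b \<le> (a + b)\<^sup>2 div 4" for a b :: nat
proof -
  have "0 \<le> (int a - int b)\<^sup>2" by simp
  then have "int (4 * (a * b)) \<le> int ((a + b)\<^sup>2)"
    by (simp add: power2_eq_square algebra_simps)
  then have "4 * (a * b) \<le> (a + b)\<^sup>2" by linarith
  then show ?thesis by simp
qed

text \<open>The growth of the Turan bound per vertex; from \<open>n = 10\<close> on it is at least
  5, which is what the stability argument needs.\<close>

lemma square_div4_step:
  fixes n :: nat
  shows "(n - 1)\<^sup>2 div 4 + n div 2 = n\<^sup>2 div 4"
proof -
  have "\<exists>m. n = 2 * m \<or> n = 2 * m + 1" by presburger
  then obtain m where "n = 2 * m \<or> n = 2 * m + 1" by blast
  then show ?thesis
  proof
    assume n: "n = 2 * m"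
    show ?thesis
    proof (cases m)
      case (Suc j)
      have "(n - 1)\<^sup>2 = 1 + 4 * (j * j + j)" "n\<^sup>2 = 4 * (j * j + 2 * j + 1)"
        using n Suc by (simp_all add: power2_eq_square algebra_simps)
      then show ?thesis using n Suc by simp
    qed (use n in simp)
  next
    assume n: "n = 2 * m + 1"
    have "(n - 1)\<^sup>2 = 4 * (m * m)" "n\<^sup>2 = 1 + 4 * (m * m + m)"
      using n by (simp_all add: power2_eq_square algebra_simps)
    then show ?thesis using n by simp
  qed
qed

lemma choose_two_minus: "n choose 2 = (n - 1)\<^sup>2 div 4 + n\<^sup>2 div 4" for n :: nat
proof -
  have "\<exists>m. n = 2 * m \<or> n = 2 * m + 1" by presburger
  then obtain m where "n = 2 * m \<or> n = 2 * m + 1" by blast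
  then show ?thesis
  proof
    assume n: "n = 2 * m"
    show ?thesis
    proof (cases m)
      case (Suc j)
      have "(n - 1)\<^sup>2 = 1 + 4 * (j * j + j)" "n\<^sup>2 = 4 * (j * j + 2 * j + 1)"
        "n * (n - 1) = 2 * (2 * (j * j) + 3 * j + 1)"
        using n Suc by (simp_all add: power2_eq_square algebra_simps)
      then show ?thesis by (simp add: choose_two)
    qed (use n in simp)
  next
    assume n: "n = 2 * m + 1"
    have "(n - 1)\<^sup>2 = 4 * (m * m)" "n\<^sup>2 = 1 + 4 * (m * m + m)"
      "n * (n - 1) = 2 * (2 * (m * m) + m)"
      using n by (simp_all add: power2_eq_square algebra_simps)
    then show ?thesis by (simp add: choose_two)
  qed
qed

section \<open>Triangle-free graphs: Mantel's bound and its stability\<close>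

text \<open>\<open>A\<close> is the neighbourhood of a vertex of maximum degree, independent for
  lack of triangles. Summing degrees over \<open>S - A\<close> counts crossing edges once and edges
  inside \<open>S - A\<close> twice, and each degree is at most \<open>card A\<close>. The surplus
  term for \<open>S - A\<close> is kept because stability depends on it.\<close>

lemma triangle_free_split:
  assumes F: "\<forall>e\<in>F. card e = 2" and S: "finite S" and T: "triangle_free F S"
  obtains A where "A \<subseteq> S" "independent F A"
    "card (spanned F S) = arcs F (S - A) A + card (spanned F (S - A))"
    "card (spanned F S) + card (spanned F (S - A)) \<le> card A * card (S - A)"
proof -
  obtain A where A: "A \<subseteq> S" "independent F A" "\<forall>v\<in>S. card (nbhd F S v) \<le> card A"
  proof (cases "S = {}")
    case True
    then show ?thesis using that[of "{}"] by (simp add: independent_def)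
  next
    case False
    define M where "M = Max ((\<lambda>v. card (nbhd F S v)) ` S)"
    have "M \<in> (\<lambda>v. card (nbhd F S v)) ` S"
      unfolding M_def using S False by (intro Max_in) auto
    then obtain w where w: "w \<in> S" "card (nbhd F S w) = M" by auto
    have "independent F (nbhd F S w)"
      using T w by (auto simp: independent_def triangle_free_def nbhd_def)
    moreover have "\<forall>v\<in>S. card (nbhd F S v) \<le> card (nbhd F S w)"
      using S w by (simp add: M_def)
    ultimately show ?thesis using that[of "nbhd F S w"] nbhd_subset by metis
  qed
  have fin: "finite A" "finite (S - A)" using A S finite_subset by auto
  have SA: "A \<union> (S - A) = S" using A by auto
  have 1: "card (spanned F S) = arcs F (S - A) A + card (spanned F (S - A))"
    using card_spanned_split[OF F fin] A(2) unfolding SA spanned_independent[OF F] by simp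
  have "arcs F (S - A) A + arcs F (S - A) (S - A) = arcs F (S - A) S"
    using arcs_Un_right[of A "S - A" F "S - A"] fin unfolding SA by simp
  also have "\<dots> \<le> (\<Sum>v\<in>S - A. card A)"
    unfolding arcs_def using A by (intro sum_mono) auto
  finally have "arcs F (S - A) A + 2 * card (spanned F (S - A)) \<le> card A * card (S - A)"
    using handshake[OF F fin(2)] by (simp add: mult.commute)
  then show ?thesis using that[of A] A 1 by simp
qed

lemma mantel:
  assumes F: "\<forall>e\<in>F. card e = 2" and S: "finite S" and T: "triangle_free F S"
  shows "card (spanned F S) \<le> (card S)\<^sup>2 div 4"
proof -
  obtain A where A: "A \<subseteq> S"
    "card (spanned F S) + card (spanned F (S - A)) \<le> card A * card (S - A)"
    using triangle_free_split[OF assms] by metis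
  have "card A + card (S - A) = card S"
    using A(1) S by (metis card_Diff_subset card_mono finite_subset le_add_diff_inverse)
  then show ?thesis using A(2) mult_le_div4[of "card A" "card (S - A)"] by simp
qed

text \<open>Without a triangle, the non-neighbours of a vertex of maximum degree spanning an edge
  \<open>x y\<close> cost \<open>card A\<close> edges, since \<open>x\<close> and \<open>y\<close> have no common neighbour in \<open>A\<close>.\<close>

lemma mantel_stability:
  assumes F: "\<forall>e\<in>F. card e = 2" and S: "finite S" "card S \<ge> 10" and T: "triangle_free F S"
    and large: "card (spanned F S) + 2 \<ge> (card S)\<^sup>2 div 4"
  obtains A where "A \<subseteq> S" "independent F A" "independent F (S - A)"
proof -
  obtain A where A: "A \<subseteq> S" "independent F A"
    "card (spanned F S) = arcs F (S - A) A + card (spanned F (S - A))"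
    "card (spanned F S) + card (spanned F (S - A)) \<le> card A * card (S - A)"
    using triangle_free_split[OF F S(1) T] by metis
  have sum: "card A + card (S - A) = card S"
    using A(1) S by (metis card_Diff_subset card_mono finite_subset le_add_diff_inverse)
  have fin: "finite A" "finite (S - A)" using A S finite_subset by auto
  have "independent F (S - A)"
  proof (rule ccontr)
    assume "\<not> independent F (S - A)"
    then obtain x y where xy: "x \<in> S - A" "y \<in> S - A" "{x, y} \<in> F"
      by (auto simp: independent_def)
    then have "x \<noteq> y" using F by force
    have "nbhd F A x \<inter> nbhd F A y = {}"
      using T xy A(1) by (fastforce simp: triangle_free_def nbhd_def insert_commute)
    then have "card (nbhd F A x) + card (nbhd F A y) = card (nbhd F A x \<union> nbhd F A y)"
      using fin by (simp add: card_Un_disjoint nbhd_def)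
    also have "\<dots> \<le> card A" using fin by (intro card_mono) (auto simp: nbhd_def)
    finally have xyA: "card (nbhd F A x) + card (nbhd F A y) \<le> card A" .
    define R where "R = S - A - {x, y}"
    have R: "S - A = {x, y} \<union> R" "finite R" "{x, y} \<inter> R = {}"
      using xy fin by (auto simp: R_def)
    have cR: "card (S - A) = card R + 2"
      using R \<open>x \<noteq> y\<close> by (simp add: card_Un_disjoint)
    have "arcs F R A \<le> (\<Sum>v\<in>R. card A)"
      unfolding arcs_def using fin by (intro sum_mono card_mono nbhd_subset)
    moreover have "arcs F (S - A) A = card (nbhd F A x) + card (nbhd F A y) + arcs F R A"
      using R \<open>x \<noteq> y\<close> arcs_Un_left[of "{x, y}" R F A] by (simp add: arcs_def)
    ultimately have "arcs F (S - A) A \<le> card A + card A * card R"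
      using xyA by (simp add: mult.commute)
    \<comment> \<open>As far as edges to \<open>A\<close> are concerned, \<open>x\<close> and
      \<open>y\<close> together act like one vertex, so the product bound is that for
      \<open>card S - 1\<close> vertices.\<close>
    also have "\<dots> = card A * (card R + 1)" by simp
    also have "\<dots> \<le> (card A + (card R + 1))\<^sup>2 div 4" by (rule mult_le_div4)
    also have "card A + (card R + 1) = card S - 1" using sum cR by simp
    finally have 1: "arcs F (S - A) A \<le> (card S - 1)\<^sup>2 div 4" .
    \<comment> \<open>The sum of both edge counts is at most \<open>(card S)\<^sup>2 div 4\<close>,
      and the first falls short of that by at most 2.\<close>
    have "card (spanned F (S - A)) \<le> 2"
      using A(4) large mult_le_div4[of "card A" "card (S - A)"] sum by simp
    \<comment> \<open>The two allowances of 2 would give \<open>card S div 2 \<le> 4\<close>,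
      contrary to \<open>card S \<ge> 10\<close>.\<close>
    then show False
      using 1 A(3) large S(2) square_div4_step[of "card S"] by simp
  qed
  then show ?thesis using that A by blast
qed

section \<open>Diamond-free graphs: deleting triangles\<close>

lemma triangle_recursion:
  assumes F: "\<forall>e\<in>F. card e = 2" and S: "finite S" and D: "diamond_free F S"
    and T: "\<not> triangle_free F S"
  obtains R where "R \<subseteq> S" "card S = card R + 3"
    "card (spanned F S) \<le> card S + card (spanned F R)"
proof -
  obtain a b c where abc: "a \<in> S" "b \<in> S" "c \<in> S" "{a, b} \<in> F" "{a, c} \<in> F" "{b, c} \<in> F"
    using T by (auto simp: triangle_free_def)
  then have ne: "a \<noteq> b" "a \<noteq> c" "b \<noteq> c" using F by force+
  define R where "R = S - {a, b, c}"
  have R: "S = {a, b, c} \<union> R" "finite R" "{a, b, c} \<inter> R = {}"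
    using abc S by (auto simp: R_def)
  have "card S = card {a, b, c} + card R"
    unfolding R(1) using R(2,3) by (intro card_Un_disjoint) auto
  then have cS: "card S = card R + 3" using ne by simp
  have "card (nbhd F {a, b, c} v) \<le> 1" if v: "v \<in> R" for v
  proof -
    have vS: "v \<in> S" and v': "v \<noteq> a" "v \<noteq> b" "v \<noteq> c" using v by (auto simp: R_def)
    have comm: "{b, a} = {a, b}" "{c, a} = {a, c}" "{c, b} = {b, c}" by auto
    \<comment> \<open>A vertex \<open>v\<close> adjacent to both \<open>p\<close> and
      \<open>q\<close> would form a diamond with common edge \<open>{p, q}\<close> and tips
      \<open>r\<close> and \<open>v\<close>.\<close>
    have dia: "\<not> ({p, v} \<in> F \<and> {q, v} \<in> F)"
      if "distinct [p, q, r]" "{p, q, r} = {a, b, c}" "{p, q} \<in> F" "{p, r} \<in> F" "{q, r} \<in> F"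
      for p q r
    proof -
      have "p \<in> {a, b, c}" "q \<in> {a, b, c}" "r \<in> {a, b, c}" using that(2) by blast+
      then have "p \<in> S" "q \<in> S" "r \<in> S" "v \<noteq> p" "v \<noteq> q" "v \<noteq> r"
        using abc v' by auto
      moreover have "distinct [p, q, r, v]" using that(1) calculation(4-6) by auto
      ultimately show ?thesis
        using D[unfolded diamond_free_def, rule_format, of p q r v] vS that(3-5) by blast
    qed
    have "\<not> ({a, v} \<in> F \<and> {b, v} \<in> F)" "\<not> ({a, v} \<in> F \<and> {c, v} \<in> F)"
      "\<not> ({b, v} \<in> F \<and> {c, v} \<in> F)"
      by (rule dia[of a b c] dia[of a c b] dia[of b c a];
          use ne abc in \<open>auto simp: comm\<close>)+
    then have "\<exists>w. nbhd F {a, b, c} v \<subseteq> {w}"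
      by (auto simp: nbhd_def insert_commute)
    then obtain w where "nbhd F {a, b, c} v \<subseteq> {w}" by blast
    then have "card (nbhd F {a, b, c} v) \<le> card {w}" by (intro card_mono) auto
    then show ?thesis by simp
  qed
  then have "arcs F R {a, b, c} \<le> (\<Sum>v\<in>R. 1)"
    unfolding arcs_def by (intro sum_mono) auto
  moreover have "card (spanned F {a, b, c}) \<le> 3"
  proof -
    have "card (spanned F {a, b, c}) \<le> card (pairs {a, b, c})"
      using F by (intro card_mono finite_pairs) (auto simp: spanned_def pairs_def)
    also have "\<dots> = 3" using ne by (simp add: card_pairs choose_two)
    finally show ?thesis .
  qed
  \<comment> \<open>At most \<open>card R\<close> crossing edges and 3 edges of the triangle make
    \<open>card S\<close>.\<close>
  ultimately have "card (spanned F S) \<le> card S + card (spanned F R)"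
    using card_spanned_split[OF F, of "{a, b, c}" R] R cS by simp
  then show ?thesis using that[of R] cS R by blast
qed

lemma diamond_free_subset: "diamond_free F S \<Longrightarrow> R \<subseteq> S \<Longrightarrow> diamond_free F R"
  unfolding diamond_free_def by blast

text \<open>With \<open>m\<close> vertices left after deleting a triangle, the edge count drops by
  at most \<open>m + 3\<close>; comparing with this growth leaves a deficit of at least
  \<open>(m + 1) div 2 - 1\<close>.\<close>

lemma square_div4_step3:
  fixes m :: nat
  shows "(m + 3)\<^sup>2 div 4 = m\<^sup>2 div 4 + m + (m + 1) div 2 + 2"
proof -
  have sub: "m + 1 - 1 = m" "m + 2 - 1 = m + 1" "m + 3 - 1 = m + 2" by simp_all
  have "m\<^sup>2 div 4 + (m + 1) div 2 = (m + 1)\<^sup>2 div 4"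
    "(m + 1)\<^sup>2 div 4 + (m + 2) div 2 = (m + 2)\<^sup>2 div 4"
    "(m + 2)\<^sup>2 div 4 + (m + 3) div 2 = (m + 3)\<^sup>2 div 4"
    using square_div4_step[of "m + 1"] square_div4_step[of "m + 2"] square_div4_step[of "m + 3"]
    unfolding sub by blast+
  moreover have "(m + 1) div 2 + (m + 2) div 2 = m + 1" "(m + 3) div 2 = (m + 1) div 2 + 1"
    by presburger+
  \<comment> \<open>Once the quotients are replaced by variables, only linear arithmetic
    remains.\<close>
  moreover have "d = a + m + x + 2"
    if "a + x = b" "b + y = c" "c + z = d" "x + y = m + 1" "z = x + 1"
    for a b c d x y z :: nat
    using that by simp
  ultimately show ?thesis by blast
qed

text \<open>Triangles are deleted until none is left and Mantel's bound applies. Order 3 is a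
  genuine exception: a triangle has 3 edges, but \<open>9 div 4 = 2\<close>.\<close>

lemma diamond_free_bound:
  assumes F: "\<forall>e\<in>F. card e = 2"
  shows "finite S \<Longrightarrow> diamond_free F S \<Longrightarrow> card S \<noteq> 3 \<Longrightarrow> card (spanned F S) \<le> (card S)\<^sup>2 div 4"
proof (induction "card S" arbitrary: S rule: less_induct)
  case less
  show ?case
  proof (cases "triangle_free F S")
    case True
    then show ?thesis using mantel F less by blast
  next
    case False
    obtain R where R: "R \<subseteq> S" "card S = card R + 3"
      "card (spanned F S) \<le> card S + card (spanned F R)"
      using triangle_recursion[OF F less(2,3) False] by metis
    have fR: "finite R" using R less finite_subset by blast
    show ?thesis
    proof (cases "card R = 3")
      case True
      \<comment> \<open>The induction hypothesis excludes order 3, but the trivial bound 3 suffices: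
        \<open>6 + 3 = 36 div 4\<close>.\<close>
      have "card (spanned F R) \<le> card (pairs R)"
        using F fR by (intro card_mono finite_pairs) (auto simp: spanned_def pairs_def)
      then have "card (spanned F R) \<le> 3" using True fR by (simp add: card_pairs choose_two)
      then show ?thesis using R True by simp
    next
      case 3: False
      have "card (spanned F R) \<le> (card R)\<^sup>2 div 4"
        using less(1)[OF _ fR diamond_free_subset[OF less(3) R(1)] 3] R(2) by simp
      \<comment> \<open>This makes \<open>(card R + 1) div 2\<close> at least 1, so the deletion of
        the triangle is paid for.\<close>
      moreover have "card R \<noteq> 0" using R less by simp
      ultimately show ?thesis
        using R(2,3) square_div4_step3[of "card R"] by simp
    qed
  qed
qed

lemma diamond_free_stability:
  assumes F: "\<forall>e\<in>F. card e = 2" and S: "finite S" "card S \<ge> 10" and D: "diamond_free F S"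
    and large: "card (spanned F S) + 2 \<ge> (card S)\<^sup>2 div 4"
  obtains A where "A \<subseteq> S" "independent F A" "independent F (S - A)"
proof (cases "triangle_free F S")
  case True
  then show ?thesis using mantel_stability[OF F S _ large] that by metis
next
  case False
  obtain R where R: "R \<subseteq> S" "card S = card R + 3"
    "card (spanned F S) \<le> card S + card (spanned F R)"
    using triangle_recursion[OF F S(1) D False] by metis
  have "card (spanned F R) \<le> (card R)\<^sup>2 div 4"
    using diamond_free_bound[OF F, of R] R S D diamond_free_subset finite_subset by fastforce
  \<comment> \<open>Here \<open>card R \<ge> 7\<close>, so a triangle would leave a deficit of at
    least 3, while \<open>large\<close> allows only 2.\<close>
  then show ?thesis
    using R S large square_div4_step3[of "card R"] by simp
qed

section \<open>Edge counts of two cliques\<close>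

lemma choose_two_add: "(a + b) choose 2 = (a choose 2) + (b choose 2) + a * b" for a b :: nat
  by (induction a) (simp_all add: numeral_2_eq_2)

text \<open>With \<open>d = b - a\<close>, the square is \<open>d * d + 4 * (a * b)\<close>, so
  rounding down absorbs the excess exactly when \<open>d * d < 4\<close>, that is
  \<open>d \<le> 1\<close>.\<close>

lemma balanced:
  fixes a b :: nat
  assumes "a \<le> b"
  shows "a * b = (a + b)\<^sup>2 div 4 \<longleftrightarrow> a = (a + b) div 2"
proof -
  obtain d where b: "b = a + d" using assms le_Suc_ex by blast
  have "(a + b)\<^sup>2 = d * d + 4 * (a * b)"
    by (simp add: b power2_eq_square algebra_simps)
  then have "a * b = (a + b)\<^sup>2 div 4 \<longleftrightarrow> d * d < 4"
    by (auto simp: div_eq_0_iff)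
  also have "\<dots> \<longleftrightarrow> d < 2"
    using power2_less_imp_less[of d 2] power_strict_mono[of d 2 2] by (auto simp: power2_eq_square)
  also have "\<dots> \<longleftrightarrow> a = (a + b) div 2" by (auto simp: b)
  finally show ?thesis .
qed

text \<open>Pairs inside the parts and pairs across add up to a constant, so the inside count is
  smallest where the product is largest.\<close>

lemma sum_choose_two_ge: "((a + b - 1)\<^sup>2 div 4) \<le> (a choose 2) + (b choose 2)" for a b :: nat
  using choose_two_add[of a b] choose_two_minus[of "a + b"] mult_le_div4[of a b] by simp

lemma sum_choose_two_eq:
  fixes a b :: nat
  assumes "a \<le> b"
  shows "(a choose 2) + (b choose 2) = (a + b - 1)\<^sup>2 div 4 \<longleftrightarrow> a = (a + b) div 2"
proof -
  have "c = m \<longleftrightarrow> p = q" if "c + p = m + q" for c m p q :: nat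
    using that by auto
  then show ?thesis
    using choose_two_add[of a b] choose_two_minus[of "a + b"] balanced[OF assms] by metis
qed

lemma card_two_cliques:
  assumes "finite A" "finite B" "A \<inter> B = {}" "finite C" "C \<inter> pairs A = {}" "C \<inter> pairs B = {}"
  shows "card (pairs A \<union> pairs B \<union> C) = (card A choose 2) + (card B choose 2) + card C"
proof -
  have "pairs A \<inter> pairs B = {}"
  proof -
    have False if "e \<in> pairs A" "e \<in> pairs B" for e
    proof -
      have "e \<subseteq> A \<inter> B" "card e = 2" using that by (auto simp: pairs_def)
      then show False using assms(3) by simp
    qed
    then show ?thesis by blast
  qed
  then show ?thesis
    using assms by (subst card_Un_disjoint; auto simp: finite_pairs card_Un_disjoint card_pairs)
qed

lemma crossing_not_in_pairs:
  assumes "A \<inter> B = {}" "x \<in> A" "y \<in> B"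
  shows "{x, y} \<notin> pairs A" "{x, y} \<notin> pairs B"
  using assms by (auto simp: pairs_def)

lemma num_edges_B_plus:
  assumes n: "n \<ge> 4"
  shows "num_edges (B_plus n) = (n - 1)\<^sup>2 div 4 + 2"
proof -
  define h where "h = n div 2"
  have h: "h \<ge> 2" "h + 1 < n" "h \<le> n - h" using n by (auto simp: h_def)
  let ?C = "{{0, h}, {1, h + 1}}"
  have "card (pairs {0..<h} \<union> pairs {h..<n} \<union> ?C)
      = (card {0..<h} choose 2) + (card {h..<n} choose 2) + card ?C"
    using h by (intro card_two_cliques) (auto simp: pairs_def)
  moreover have "card ?C = 2" using h by (simp add: doubleton_eq_iff)
  ultimately show ?thesis
    using sum_choose_two_eq[OF h(3)] h by (simp add: num_edges_def B_plus_def h_def)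
qed

section \<open>Isomorphism with \<open>B_plus n\<close>\<close>

text \<open>In this form edge sets can be counted and computed as images instead of being compared
  pair by pair.\<close>

lemma graph_iso_iff_image:
  assumes G: "edges G \<subseteq> pairs (verts G)" and H: "edges H \<subseteq> pairs (verts H)"
  shows "graph_iso G H \<longleftrightarrow> (\<exists>f. bij_betw f (verts G) (verts H) \<and> (`) f ` edges G = edges H)"
proof -
  have "(\<forall>u\<in>verts G. \<forall>v\<in>verts G. {u, v} \<in> edges G \<longleftrightarrow> {f u, f v} \<in> edges H)
      \<longleftrightarrow> (`) f ` edges G = edges H" (is "?L \<longleftrightarrow> ?R")
    if f: "bij_betw f (verts G) (verts H)" for f
  proof
    assume L: ?L
    show ?R
    proof (intro equalityI subsetI)
      fix e assume "e \<in> (`) f ` edges G"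
      then obtain d where d: "d \<in> edges G" "e = f ` d" by blast
      then obtain u v where "d = {u, v}" "u \<in> verts G" "v \<in> verts G"
        using G by (auto simp: pairs_def card_2_iff subset_iff)
      then show "e \<in> edges H" using L d by simp
    next
      fix e assume e: "e \<in> edges H"
      then obtain p q where "e = {p, q}" "p \<in> verts H" "q \<in> verts H"
        using H by (auto simp: pairs_def card_2_iff subset_iff)
      moreover have "verts H = f ` verts G" using f by (simp add: bij_betw_def)
      ultimately obtain u v where uv: "u \<in> verts G" "v \<in> verts G" "e = {f u, f v}" by auto
      then have "{u, v} \<in> edges G" "e = f ` {u, v}" using L e by auto
      then show "e \<in> (`) f ` edges G" by blast
    qed
  next
    assume R: ?R
    have inj: "inj_on f (verts G)" using f by (simp add: bij_betw_def)
    show ?L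
    proof (intro ballI iffI)
      fix u v assume "{u, v} \<in> edges G"
      then have "f ` {u, v} \<in> edges H" using R by blast
      then show "{f u, f v} \<in> edges H" by simp
    next
      fix u v assume uv: "u \<in> verts G" "v \<in> verts G" "{f u, f v} \<in> edges H"
      then obtain d where d: "d \<in> edges G" "f ` d = f ` {u, v}"
        using R by (metis image_empty image_iff image_insert)
      then have "d \<subseteq> verts G" "{u, v} \<subseteq> verts G" using G uv by (auto simp: pairs_def)
      then have "d = {u, v}" using inj_on_image_eq_iff[OF inj] d(2) by metis
      then show "{u, v} \<in> edges G" using d by simp
    qed
  qed
  then show ?thesis unfolding graph_iso_def by (intro ex_cong1 conj_cong refl)
qed

lemma graph_iso_num_edges:
  assumes G: "simple_graph G" and H: "simple_graph H" and "graph_iso G H"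
  shows "num_edges G = num_edges H"
proof -
  obtain f where f: "bij_betw f (verts G) (verts H)" "(`) f ` edges G = edges H"
    using assms graph_iso_iff_image[of G H] by (auto simp: simple_graph_def)
  have "inj_on ((`) f) (edges G)"
    by (rule inj_on_subset[OF inj_on_image_Pow[of f "verts G"]])
      (use f G in \<open>auto simp: bij_betw_def simple_graph_def pairs_def\<close>)
  then show ?thesis using f(2) by (metis card_image num_edges_def)
qed

lemma image_pairs:
  assumes "inj_on f A"
  shows "(`) f ` pairs A = pairs (f ` A)"
proof (intro equalityI subsetI)
  fix e assume "e \<in> (`) f ` pairs A"
  then obtain d where d: "d \<subseteq> A" "card d = 2" "e = f ` d" by (auto simp: pairs_def)
  then have "card e = 2" using assms card_image inj_on_subset by metis
  then show "e \<in> pairs (f ` A)" using d by (auto simp: pairs_def)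
next
  fix e assume e: "e \<in> pairs (f ` A)"
  then obtain d where d: "d \<subseteq> A" "e = f ` d" by (auto simp: pairs_def subset_image_iff)
  then have "card d = 2" using assms e card_image[of f d] inj_on_subset by (auto simp: pairs_def)
  then show "e \<in> (`) f ` pairs A" using d by (auto simp: pairs_def)
qed

text \<open>Vertices of a clique are interchangeable, so only the ends of the two added edges need
  prescribed labels; the rest may be numbered arbitrarily.\<close>

lemma ex_bij_betw_two_points:
  assumes A: "finite A" "x \<in> A" "x' \<in> A" "x \<noteq> x'"
  obtains f where "bij_betw f A {k..<k + card A}" "f x = k" "f x' = k + 1"
proof -
  define R where "R = A - {x, x'}"
  have R: "finite R" "A = {x, x'} \<union> R" "{x, x'} \<inter> R = {}" using A by (auto simp: R_def)
  have cA: "card A = card R + 2" using R A(4) by (simp add: card_Un_disjoint)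
  have "card R = card {k + 2..<k + card A}" using cA by simp
  then obtain g where g: "bij_betw g R {k + 2..<k + card A}"
    using R(1) finite_same_card_bij finite_atLeastLessThan by blast
  define f where "f v = (if v = x then k else if v = x' then k + 1 else g v)" for v
  have "bij_betw f {x, x'} {k, k + 1}" using A(4) by (auto simp: bij_betw_def f_def)
  moreover have "bij_betw f R {k + 2..<k + card A}"
    using g R(3) by (subst bij_betw_cong[of R f g]) (auto simp: f_def)
  moreover have "{k, k + 1} \<inter> {k + 2..<k + card A} = {}" by auto
  ultimately have "bij_betw f ({x, x'} \<union> R) ({k, k + 1} \<union> {k + 2..<k + card A})"
    by (rule bij_betw_combine)
  moreover have "{k, k + 1} \<union> {k + 2..<k + card A} = {k..<k + card A}" using cA by auto
  ultimately show ?thesis using that[of f] R(2) A(4) by (auto simp: f_def)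
qed

lemma two_cliques_iso_B_plus:
  assumes V: "verts G = A \<union> B" "A \<inter> B = {}" "finite A" "finite B"
    and card: "card A = n div 2" "card B = n - n div 2"
    and xy: "x \<in> A" "x' \<in> A" "x \<noteq> x'" "y \<in> B" "y' \<in> B" "y \<noteq> y'"
    and E: "edges G = pairs A \<union> pairs B \<union> {{x, y}, {x', y'}}"
  shows "graph_iso G (B_plus n)"
proof -
  define h where "h = n div 2"
  have h: "h \<le> n" by (simp add: h_def)
  obtain f where f: "bij_betw f A {0..<h}" "f x = 0" "f x' = 1"
    using ex_bij_betw_two_points[OF V(3) xy(1-3), of 0] card by (auto simp: h_def)
  obtain g where g: "bij_betw g B {h..<n}" "g y = h" "g y' = h + 1"
    using ex_bij_betw_two_points[OF V(4) xy(4-6), of h] card h by (auto simp: h_def)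
  define k where "k v = (if v \<in> A then f v else g v)" for v
  have kA: "bij_betw k A {0..<h}"
    using f(1) by (subst bij_betw_cong[of A k f]) (auto simp: k_def)
  have kB: "bij_betw k B {h..<n}"
    using g(1) V(2) by (subst bij_betw_cong[of B k g]) (auto simp: k_def)
  have "bij_betw k (A \<union> B) ({0..<h} \<union> {h..<n})"
    by (rule bij_betw_combine[OF kA kB]) auto
  moreover have "{0..<h} \<union> {h..<n} = {0..<n}" using h by auto
  ultimately have bij: "bij_betw k (verts G) (verts (B_plus n))"
    using V(1) by (simp add: B_plus_def)
  have k: "k x = 0" "k x' = 1" "k y = h" "k y' = h + 1"
    using xy f g V(2) by (auto simp: k_def)
  have "(`) k ` edges G = edges (B_plus n)"
    using kA kB k by (simp add: E image_Un image_pairs bij_betw_def B_plus_def h_def)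
  moreover have "edges G \<subseteq> pairs (verts G)"
    unfolding E V(1) using xy V(2) by (auto simp: pairs_def card_insert_if)
  moreover have "edges (B_plus n) \<subseteq> pairs (verts (B_plus n))"
  proof -
    \<comment> \<open>No bound on \<open>n\<close> is assumed; it follows because the labels
      \<open>h + 1\<close> and \<open>1\<close> occur in the two ranges.\<close>
    have "h + 1 < n" using g bij_betwE[OF g(1)] xy by fastforce
    moreover have "1 < h" using f bij_betwE[OF f(1)] xy by fastforce
    ultimately have "n \<ge> 4" by (simp add: h_def)
    then show ?thesis using simple_graph_B_plus by (auto simp: simple_graph_def)
  qed
  ultimately show ?thesis using bij graph_iso_iff_image[of G "B_plus n"] by (metis (no_types))
qed

section \<open>Two disjoint edges between the cliques, and the bound they give\<close>

text \<open>Without a crossing edge, a walk starting in \<open>A\<close> could never leave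
  \<open>A\<close>.\<close>

lemma connected_crossing_edge:
  assumes "connected_graph H" "edges H \<subseteq> Pow (verts H)" "verts H = A \<union> B" "a \<in> A" "b \<in> B"
    "A \<inter> B = {}"
  obtains x y where "x \<in> A" "y \<in> B" "{x, y} \<in> edges H"
proof -
  have "\<exists>x\<in>A. \<exists>y\<in>B. {x, y} \<in> edges H"
  proof (rule ccontr)
    assume no: "\<not> ?thesis"
    have "(a, b) \<in> (adj_rel H)\<^sup>*" using assms by (simp add: connected_graph_def)
    then have "b \<in> A"
    proof induction
      case (step u v)
      then have "{u, v} \<in> edges H" by (simp add: adj_rel_def)
      then show ?case using no step assms by blast
    qed (rule assms)
    then show False using assms by blast
  qed
  then show ?thesis using that by blast
qed

lemma two_connected_disjoint_crossings:
  assumes G: "simple_graph G" "k_connected 2 G"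
    and V: "verts G = A \<union> B" "A \<inter> B = {}" "card A \<ge> 2" "card B \<ge> 2"
  obtains x x' y y' where "x \<in> A" "x' \<in> A" "x \<noteq> x'" "y \<in> B" "y' \<in> B" "y \<noteq> y'"
    "{x, y} \<in> edges G" "{x', y'} \<in> edges G"
proof -
  have avoid: "\<exists>x\<in>A - {w}. \<exists>y\<in>B - {w}. {x, y} \<in> edges G" if w: "w \<in> verts G" for w
  proof -
    have "A - {w} \<noteq> {}" "B - {w} \<noteq> {}"
      using V(3,4) by (metis Diff_eq_empty_iff card.empty card_insert_disjoint card_mono
          finite.emptyI finite.insertI insert_absorb le_trans not_less_eq_eq numeral_2_eq_2
          card_1_singleton_iff empty_iff One_nat_def)+
    then obtain a b where ab: "a \<in> A - {w}" "b \<in> B - {w}" by blast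
    let ?H = "induced G (verts G - {w})"
    have "connected_graph ?H" using G(2) w by (simp add: k_connected_def)
    then obtain x y where "x \<in> A - {w}" "y \<in> B - {w}" "{x, y} \<in> edges ?H"
      by (rule connected_crossing_edge[OF _ _ _ ab]) (use V in \<open>auto simp: induced_def\<close>)
    then show ?thesis by (auto simp: induced_def)
  qed
  \<comment> \<open>The choice of \<open>w\<close> is arbitrary; it only serves to produce a first
    crossing edge.\<close>
  obtain w where "w \<in> A" using V(3) by fastforce
  then obtain x y where xy: "x \<in> A" "y \<in> B" "{x, y} \<in> edges G" using avoid V(1) by blast
  then obtain p q where pq: "p \<in> A" "q \<in> B" "{p, q} \<in> edges G" "p \<noteq> x"
    using avoid[of x] V(1) by blast
  obtain r s where rs: "r \<in> A" "s \<in> B" "{r, s} \<in> edges G" "s \<noteq> y"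
    using avoid[of y] xy V(1) by blast
  \<comment> \<open>The second edge avoids \<open>x\<close> and the third avoids \<open>y\<close>.
    If each still meets the first, they are \<open>{p, y}\<close> and \<open>{x, s}\<close>, which
    are disjoint from each other.\<close>
  consider "q \<noteq> y" | "r \<noteq> x" | "q = y" "r = x" by blast
  then show ?thesis
  proof cases
    case 1
    show ?thesis by (rule that[of x p y q]) (use xy pq 1 in simp_all)
  next
    case 2
    show ?thesis by (rule that[of x r y s]) (use xy rs 2 in simp_all)
  next
    case 3
    show ?thesis by (rule that[of p x y s]) (use xy pq rs 3 in simp_all)
  qed
qed

lemma two_cliques_bound:
  assumes G: "simple_graph G" "k_connected 2 G" "order G = n" "n \<ge> 10"
    and V: "verts G = A \<union> B" "A \<inter> B = {}" "card A \<le> card B"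
    and E: "pairs A \<subseteq> edges G" "pairs B \<subseteq> edges G"
  shows "num_edges G \<ge> (n - 1)\<^sup>2 div 4 + 2"
    and "num_edges G = (n - 1)\<^sup>2 div 4 + 2 \<Longrightarrow> graph_iso G (B_plus n)"
proof -
  have fin: "finite A" "finite B" "finite (edges G)"
    using G(1) V(1) finite_subset[OF _ finite_pairs] by (auto simp: simple_graph_def)
  have n: "card A + card B = n" using G(3) V fin by (simp add: order_def card_Un_disjoint)
  have "num_edges G \<ge> (n - 1)\<^sup>2 div 4 + 2 \<and>
    (num_edges G = (n - 1)\<^sup>2 div 4 + 2 \<longrightarrow> graph_iso G (B_plus n))"
  proof (cases "card A \<ge> 2")
    case False
    \<comment> \<open>Now \<open>B\<close> has at least \<open>n - 1\<close> vertices, and its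
      clique alone exceeds \<open>(n - 1)\<^sup>2 div 4\<close> by at least 16, so equality cannot
      occur.\<close>
    have "card (pairs B) \<le> num_edges G" using E fin by (simp add: num_edges_def card_mono)
    moreover have "(n - 1) choose 2 \<le> card B choose 2"
      using n False by (intro binomial_right_mono) auto
    moreover have "(n - 1) choose 2 = (n - 1 - 1)\<^sup>2 div 4 + (n - 1)\<^sup>2 div 4"
      by (rule choose_two_minus)
    moreover have "8\<^sup>2 div 4 \<le> (n - 1 - 1)\<^sup>2 div 4"
      using G(4) by (intro div_le_mono power_mono) auto
    ultimately show ?thesis using fin by (simp add: card_pairs)
  next
    case True
    obtain x x' y y' where xy: "x \<in> A" "x' \<in> A" "x \<noteq> x'" "y \<in> B" "y' \<in> B" "y \<noteq> y'"
      "{x, y} \<in> edges G" "{x', y'} \<in> edges G"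
      by (rule two_connected_disjoint_crossings[OF G(1,2) V(1,2) True]) (use V(3) True in linarith)+
    let ?C = "{{x, y}, {x', y'}}"
    let ?E = "pairs A \<union> pairs B \<union> ?C"
    have "card ?E = (card A choose 2) + (card B choose 2) + card ?C"
      using fin xy V(2) crossing_not_in_pairs[OF V(2)] by (intro card_two_cliques) auto
    moreover have "card ?C = 2" using xy V(2) by (auto simp: card_insert_if doubleton_eq_iff)
    ultimately have cE: "card ?E = (card A choose 2) + (card B choose 2) + 2" by simp
    have sub: "?E \<subseteq> edges G" using E xy by auto
    then have le: "card ?E \<le> num_edges G" using fin by (simp add: num_edges_def card_mono)
    have ge: "(n - 1)\<^sup>2 div 4 \<le> (card A choose 2) + (card B choose 2)"
      using sum_choose_two_ge[of "card A" "card B"] n by simp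
    have "graph_iso G (B_plus n)" if eq: "num_edges G = (n - 1)\<^sup>2 div 4 + 2"
    proof -
      \<comment> \<open>Equality leaves no room for further edges and makes the clique sizes
        optimal, hence balanced.\<close>
      have "?E = edges G"
        using sub le ge eq cE fin by (intro card_seteq) (auto simp: num_edges_def)
      moreover have "card A = n div 2"
        using sum_choose_two_eq[OF V(3)] le ge eq cE n by simp
      ultimately show ?thesis
        using two_cliques_iso_B_plus[OF V(1,2) fin(1,2) _ _ xy(1-6)] n by auto
    qed
    then show ?thesis using le ge cE by linarith
  qed
  then show "num_edges G \<ge> (n - 1)\<^sup>2 div 4 + 2"
    and "num_edges G = (n - 1)\<^sup>2 div 4 + 2 \<Longrightarrow> graph_iso G (B_plus n)" by blast+
qed

section \<open>Passing to the complement, and the theorem\<close>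

text \<open>A diamond in the complement takes five of the six pairs on its vertices, leaving
  \<open>G\<close> at most the edge \<open>{c, d}\<close> there.\<close>

lemma complement_diamond_free:
  assumes G: "edges G \<subseteq> pairs (verts G)" and st: "st_graph 4 2 G"
  shows "diamond_free (pairs (verts G) - edges G) (verts G)"
  unfolding diamond_free_def
proof (intro ballI impI notI)
  let ?F = "pairs (verts G) - edges G"
  fix a b c d
  assume V: "a \<in> verts G" "b \<in> verts G" "c \<in> verts G" "d \<in> verts G" and dist: "distinct [a, b, c, d]"
    and F: "{a, b} \<in> ?F \<and> {a, c} \<in> ?F \<and> {b, c} \<in> ?F \<and> {a, d} \<in> ?F \<and> {b, d} \<in> ?F"
  let ?S = "{a, b, c, d}"
  have "edges (induced G ?S) \<subseteq> {{c, d}}"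
  proof
    fix e assume "e \<in> edges (induced G ?S)"
    then have e: "e \<in> edges G" "e \<subseteq> ?S" by (auto simp: induced_def)
    then have "card e = 2" using G by (auto simp: pairs_def)
    then obtain p q where pq: "e = {p, q}" "p \<noteq> q" by (auto simp: card_2_iff)
    then have "p \<in> ?S" "q \<in> ?S" using e by auto
    then show "e \<in> {{c, d}}" using F e pq by (auto simp: insert_commute)
  qed
  then have "card (edges (induced G ?S)) \<le> card {{c, d}}" by (intro card_mono) auto
  moreover have "card ?S = 4" using dist by simp
  then have "2 \<le> num_edges (induced G ?S)" using st V by (simp add: st_graph_def)
  ultimately show False by (simp add: num_edges_def)
qed

lemma independent_complement:
  assumes "independent (pairs V - E) A" "A \<subseteq> V"
  shows "pairs A \<subseteq> E"
proof
  fix e assume "e \<in> pairs A"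
  then have e: "e \<subseteq> A" "card e = 2" by (auto simp: pairs_def)
  then obtain p q where "e = {p, q}" by (auto simp: card_2_iff)
  then show "e \<in> E" using e assms by (auto simp: independent_def pairs_def)
qed

theorem theorem11:
  fixes G :: "'a ugraph" and n :: nat
  assumes "simple_graph G"
    and "k_connected 2 G"
    and "st_graph 4 2 G"
    and "order G = n"
    and "n \<ge> 10"
  shows "num_edges G \<ge> (n - 1)\<^sup>2 div 4 + 2 \<and>
    (num_edges G = (n - 1)\<^sup>2 div 4 + 2 \<longleftrightarrow> graph_iso G (B_plus n))"
proof -
  let ?V = "verts G" and ?M = "(n - 1)\<^sup>2 div 4 + 2"
  have G: "finite ?V" "edges G \<subseteq> pairs ?V" and V: "card ?V = n"
    using assms by (auto simp: simple_graph_def order_def)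
  define F where "F = pairs ?V - edges G"
  have F: "\<forall>e\<in>F. card e = 2" by (auto simp: F_def pairs_def)
  have D: "diamond_free F ?V"
    unfolding F_def using complement_diamond_free G(2) assms(3) by blast
  have "num_edges G \<le> card (pairs ?V)"
    unfolding num_edges_def using G by (intro card_mono finite_pairs)
  moreover have "card F = card (pairs ?V) - num_edges G"
    unfolding F_def num_edges_def
    using G finite_pairs by (intro card_Diff_subset) (auto intro: finite_subset)
  ultimately have sum: "num_edges G + card F = (n - 1)\<^sup>2 div 4 + n\<^sup>2 div 4"
    using card_pairs[OF G(1)] V choose_two_minus[of n] by simp
  have F_spanned: "spanned F ?V = F" by (auto simp: spanned_def F_def pairs_def)
  have "num_edges G \<ge> ?M \<and> (num_edges G = ?M \<longrightarrow> graph_iso G (B_plus n))"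
  \<comment> \<open>By \<open>sum\<close>, failure of this inequality puts
    \<open>num_edges G\<close> strictly above \<open>?M\<close>, so only near-extremal
    \<open>F\<close> needs its structure.\<close>
  proof (cases "card F + 2 \<ge> n\<^sup>2 div 4")
    case True
    then obtain A where A: "A \<subseteq> ?V" "independent F A" "independent F (?V - A)"
      using diamond_free_stability[OF F G(1) _ D] V assms(5) F_spanned by auto
    then have E: "pairs A \<subseteq> edges G" "pairs (?V - A) \<subseteq> edges G"
      using independent_complement[of ?V "edges G"] by (auto simp: F_def)
    have U: "?V = A \<union> (?V - A)" "?V = (?V - A) \<union> A" using A(1) by auto
    \<comment> \<open>\<open>two_cliques_bound\<close> expects the smaller clique first.\<close>
    consider "card A \<le> card (?V - A)" | "card (?V - A) \<le> card A" by linarith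
    then show ?thesis
    proof cases
      case 1
      then show ?thesis
        using two_cliques_bound[OF assms(1,2,4,5) U(1) _ 1 E] by blast
    next
      case 2
      then show ?thesis
        using two_cliques_bound[OF assms(1,2,4,5) U(2) _ 2 E(2,1)] by blast
    qed
  next
    case False
    then show ?thesis using sum by simp
  qed
  moreover have "num_edges G = ?M" if "graph_iso G (B_plus n)"
    using graph_iso_num_edges[OF assms(1) simple_graph_B_plus that] num_edges_B_plus assms(5) by simp
  ultimately show ?thesis by blast
qed

end
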